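(* Let $a_1,a_2,a_3$ be three distinct points in $\mathbb{R}^n$, let $\varphi(x):=\|x-a_1\|+\|x-a_2\|+\|x-a_3\|$ for $x\in\mathbb{R}^n$, and consider the Fermat-Torricelli problem "minimize $\varphi(x)$ subject to $x\in\mathbb{R}^n$". Let $\bar x\in\mathbb{R}^n$ and, for each $i\in\{1,2,3\}$ with $\bar x\ne a_i$, put $v_i:=\dfrac{\bar x-a_i}{\|\bar x-a_i\|}$. (i) If $\bar x\notin\{a_1,a_2,a_3\}$, then $\bar x$ is the solution of the problem if and only if $\cos(v_1,v_2)=\cos(v_2,v_3)=\cos(v_3,v_1)=-1/2$. (ii) If $\bar x\in\{a_1,a_2,a_3\}$, say for definiteness $\bar x=a_1$, then $\bar x$ is the solution of the problem if and only if $\cos(v_2,v_3)\le-1/2$.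
   Context: $\|\cdot\|$ is the Euclidean norm and $\langle\cdot,\cdot\rangle$ the usual scalar product in $\mathbb{R}^n$. For nonzero $u,v\in\mathbb{R}^n$, $\cos(u,v):=\dfrac{\langle u,v\rangle}{\|u\|\cdot\|v\|}$. A solution of the problem is a global minimizer of $\varphi$ over $\mathbb{R}^n$; for three distinct points the solution is unique (also when they are collinear), which is why one speaks of "the" solution. *)

theory Defs
  imports "HOL-Analysis.Analysis"
begin

text \<open>Meaningful for nonzero \<open>u\<close> and \<open>v\<close> only (otherwise the value is \<open>0\<close>).\<close>

definition vec_cos :: "real ^ 'n \<Rightarrow> real ^ 'n \<Rightarrow> real" where
  "vec_cos u v = (u \<bullet> v) / (norm u * norm v)"

definition ft_objective :: "real ^ 'n \<Rightarrow> real ^ 'n \<Rightarrow> real ^ 'n \<Rightarrow> real ^ 'n \<Rightarrow> real" where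
  "ft_objective a1 a2 a3 x = norm (x - a1) + norm (x - a2) + norm (x - a3)"

definition ft_solution :: "real ^ 'n \<Rightarrow> real ^ 'n \<Rightarrow> real ^ 'n \<Rightarrow> real ^ 'n \<Rightarrow> bool" where
  "ft_solution a1 a2 a3 x \<longleftrightarrow> is_arg_min (ft_objective a1 a2 a3) (\<lambda>y. y \<in> UNIV) x"

end

theory Submission
  imports Defs
begin

text \<open>Everything follows from two bounds on the norm at a point \<open>u \<noteq> 0\<close>: the subgradient
  inequality \<open>\<parallel>u\<parallel> + \<langle>sgn u, h\<rangle> \<le> \<parallel>u + h\<parallel>\<close> and its quadratic counterpart
  \<open>\<parallel>u + h\<parallel> \<le> \<parallel>u\<parallel> + \<langle>sgn u, h\<rangle> + \<parallel>h\<parallel>\<^sup>2 / (2\<parallel>u\<parallel>)\<close>. Together they show that a point off the \<open>a\<^sub>i\<close>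
  is optimal iff \<open>v\<^sub>1 + v\<^sub>2 + v\<^sub>3 = 0\<close>, and that \<open>a\<^sub>1\<close> is optimal iff \<open>\<parallel>v\<^sub>2 + v\<^sub>3\<parallel> \<le> 1\<close>; for unit vectors
  these are the conditions on cosines. For uniqueness, let \<open>y\<close> and \<open>z\<close> be optimal. Then so is their
  midpoint, which makes all three triangle inequalities there tight, so that
  \<open>\<parallel>z - a\<^sub>i\<parallel> - \<parallel>y - a\<^sub>i\<parallel> = \<plusminus>\<parallel>z - y\<parallel>\<close> for each \<open>i\<close>. Three such numbers add up to
  \<open>\<phi>(z) - \<phi>(y) = 0\<close>, which by parity forces \<open>y = z\<close>.\<close>

section \<open>Norm estimates and unit vectors in inner product spaces\<close>

lemma norm_add_ge_subgradient:
  fixes u h :: "'a::real_inner"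
  assumes "u \<noteq> 0"
  shows "norm u + sgn u \<bullet> h \<le> norm (u + h)"
proof -
  have "norm u + sgn u \<bullet> h = sgn u \<bullet> (u + h)"
    using assms by (simp add: sgn_div_norm inner_add_right power2_norm_eq_inner [symmetric] power2_eq_square)
  also have "\<dots> \<le> norm (sgn u) * norm (u + h)"
    by (rule norm_cauchy_schwarz)
  finally show ?thesis
    using assms by (simp add: norm_sgn)
qed

text \<open>AM-GM replaces \<open>norm (u + h)\<close> by its square, which expands exactly;
  dividing by \<open>2 * norm u\<close> gives the bound.\<close>

lemma norm_add_le_quadratic:
  fixes u h :: "'a::real_inner"
  assumes "u \<noteq> 0"
  shows "norm (u + h) \<le> norm u + sgn u \<bullet> h + 1 / (2 * norm u) * (norm h)\<^sup>2"
proof -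
  have pos: "norm u > 0"
    using assms by simp
  have "2 * norm u * norm (u + h) \<le> (norm u)\<^sup>2 + (norm (u + h))\<^sup>2"
    by (rule sum_squares_bound)
  also have "\<dots> = 2 * (norm u)\<^sup>2 + 2 * (u \<bullet> h) + (norm h)\<^sup>2"
    by (simp add: power2_norm_eq_inner inner_add inner_commute)
  also have "\<dots> = 2 * norm u * (norm u + sgn u \<bullet> h + 1 / (2 * norm u) * (norm h)\<^sup>2)"
    using pos by (simp add: sgn_div_norm field_simps power2_eq_square)
  finally show ?thesis
    using pos by simp
qed

text \<open>For \<open>h\<close> a small negative multiple of \<open>w\<close> the linear term is
  \<open>- norm w * norm h\<close>, while the quadratic one is of higher order. The number
  \<open>e\<close> is the slope of a kink at the point: 0 off the \<open>a_i\<close>, 1 at a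
  vertex.\<close>

lemma norm_le_if_first_order:
  fixes w :: "'a::real_inner"
  assumes "C > 0" and "\<And>h. 0 \<le> e * norm h + w \<bullet> h + C * (norm h)\<^sup>2" and "e \<ge> 0"
  shows "norm w \<le> e"
proof (cases "w = 0")
  case False
  show ?thesis
  proof (rule field_le_epsilon)
    fix d :: real
    assume "d > 0"
    \<comment> \<open>With this \<open>t\<close>, the quadratic term becomes exactly
      \<open>d\<close> once \<open>t * norm w\<close> is divided out.\<close>
    define t where "t = d / (C * norm w)"
    have t: "t > 0" "C * t * norm w = d"
      using False \<open>C > 0\<close> \<open>d > 0\<close> by (simp_all add: t_def)
    have "0 \<le> e * norm (- t *\<^sub>R w) + w \<bullet> (- t *\<^sub>R w) + C * (norm (- t *\<^sub>R w))\<^sup>2"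
      by (rule assms(2))
    also have "\<dots> = t * norm w * (e - norm w + C * t * norm w)"
      using \<open>t > 0\<close> by (simp add: power2_norm_eq_inner [symmetric] power2_eq_square algebra_simps)
    finally have "0 \<le> t * norm w * (e - norm w + C * t * norm w)" .
    moreover have "t * norm w > 0"
      using t(1) False by simp
    ultimately have "0 \<le> e - norm w + C * t * norm w"
      by (metis zero_le_mult_iff not_le)
    then show "norm w \<le> e + d"
      using t(2) by simp
  qed
qed (use assms in simp)

text \<open>Pairing the sum with each vector gives three linear equations for the inner products;
  conversely the squared norm of the sum is 3 + 2 * (- 3 / 2) = 0.\<close>

lemma unit_vectors_sum_eq_0_iff:
  fixes u v w :: "'a::real_inner"
  assumes "norm u = 1" "norm v = 1" "norm w = 1"
  shows "u + v + w = 0 \<longleftrightarrow> u \<bullet> v = - 1 / 2 \<and> v \<bullet> w = - 1 / 2 \<and> w \<bullet> u = - 1 / 2"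
proof
  have sq: "u \<bullet> u = 1" "v \<bullet> v = 1" "w \<bullet> w = 1"
    using assms by (simp_all add: norm_eq_1)
  show "u \<bullet> v = - 1 / 2 \<and> v \<bullet> w = - 1 / 2 \<and> w \<bullet> u = - 1 / 2" if "u + v + w = 0"
  proof -
    have "u \<bullet> (u + v + w) = 0" "v \<bullet> (u + v + w) = 0" "w \<bullet> (u + v + w) = 0"
      using that by simp_all
    then show ?thesis
      using sq by (simp add: inner_add_right inner_commute)
  qed
  show "u + v + w = 0" if "u \<bullet> v = - 1 / 2 \<and> v \<bullet> w = - 1 / 2 \<and> w \<bullet> u = - 1 / 2"
  proof -
    have "(u + v + w) \<bullet> (u + v + w) = 0"
      using that sq by (simp add: inner_add inner_commute)
    then show ?thesis
      by simp
  qed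
qed

lemma norm_add_unit_le_1_iff:
  fixes u v :: "'a::real_inner"
  assumes "norm u = 1" "norm v = 1"
  shows "norm (u + v) \<le> 1 \<longleftrightarrow> u \<bullet> v \<le> - 1 / 2"
proof -
  have "u \<bullet> u = 1" "v \<bullet> v = 1"
    using assms by (simp_all add: norm_eq_1)
  then show ?thesis
    by (auto simp: norm_le_square inner_add inner_commute)
qed

section \<open>Existence and uniqueness of the minimizer\<close>

lemma vec_cos_unit: "norm u = 1 \<Longrightarrow> norm v = 1 \<Longrightarrow> vec_cos u v = u \<bullet> v"
  by (simp add: vec_cos_def)

lemma ft_solution_iff: "ft_solution a b c x \<longleftrightarrow> (\<forall>y. ft_objective a b c x \<le> ft_objective a b c y)"
  by (auto simp: ft_solution_def is_arg_min_linorder)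

lemma ft_solution_rotate: "ft_solution a b c = ft_solution b c a"
  by (simp add: fun_eq_iff ft_solution_iff ft_objective_def add_ac)

text \<open>Outside the ball around \<open>a\<close> of radius \<open>?f a\<close> the term
  \<open>norm (y - a)\<close> alone exceeds \<open>?f a\<close>, so a minimizer on this compact ball
  is global.\<close>

lemma ft_solution_exists: "\<exists>y. ft_solution a b c y"
proof -
  let ?f = "ft_objective a b c"
  have "continuous_on (cball a (?f a)) ?f"
    unfolding ft_objective_def by (intro continuous_intros)
  moreover have "a \<in> cball a (?f a)"
    by (simp add: ft_objective_def)
  ultimately obtain x where x: "\<And>y. y \<in> cball a (?f a) \<Longrightarrow> ?f x \<le> ?f y"
    using continuous_attains_inf [of "cball a (?f a)" ?f] compact_cball by blast
  have "?f x \<le> ?f y" for y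
  proof (cases "y \<in> cball a (?f a)")
    case False
    have "?f x \<le> ?f a"
      using x [OF \<open>a \<in> cball a (?f a)\<close>] .
    also have "\<dots> \<le> norm (y - a)"
      using False by (simp add: dist_norm norm_minus_commute)
    also have "\<dots> \<le> ?f y"
      by (simp add: ft_objective_def)
    finally show ?thesis .
  qed (rule x)
  then show ?thesis
    by (auto simp: ft_solution_iff)
qed

lemma norm_diff_if_triangle_eq:
  fixes p q :: "'a::real_inner"
  assumes "norm (p + q) = norm p + norm q"
  shows "\<bar>norm p - norm q\<bar> = norm (p - q)"
proof -
  have "p \<bullet> q = norm p * norm q"
    using assms by (simp add: norm_triangle_eq norm_cauchy_schwarz_eq)
  then have "(norm (p - q))\<^sup>2 = (norm p - norm q)\<^sup>2"
    by (simp add: power2_norm_eq_inner inner_diff inner_commute power2_diff)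
  then show ?thesis
    by (metis abs_norm_cancel power2_eq_iff abs_minus_cancel)
qed

lemma ft_solution_unique:
  assumes y: "ft_solution a b c y" and z: "ft_solution a b c z"
  shows "y = z"
proof -
  define m where "m = midpoint z y"
  have mid: "2 * norm (m - d) = norm ((z - d) + (y - d))" for d
  proof -
    have "(z - d) + (y - d) = 2 *\<^sub>R (m - d)"
      by (simp add: m_def midpoint_def scaleR_2 algebra_simps)
    then show ?thesis
      by simp
  qed
  have le: "2 * norm (m - d) \<le> norm (z - d) + norm (y - d)" for d
    unfolding mid by (rule norm_triangle_ineq)
  have eq: "ft_objective a b c z = ft_objective a b c y"
    using y z by (meson ft_solution_iff order_antisym)
  have min: "ft_objective a b c y \<le> ft_objective a b c m"
    using y by (simp add: ft_solution_iff)
  \<comment> \<open>By \<open>eq\<close> and \<open>min\<close> the three instances of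
    \<open>le\<close> add up to an equality, so none of them is strict.\<close>
  have "2 * norm (m - a) = norm (z - a) + norm (y - a)"
    "2 * norm (m - b) = norm (z - b) + norm (y - b)"
    "2 * norm (m - c) = norm (z - c) + norm (y - c)"
    using le [of a] le [of b] le [of c] eq min unfolding ft_objective_def by linarith+
  then have "\<bar>norm (z - d) - norm (y - d)\<bar> = norm (z - y)" if "d \<in> {a, b, c}" for d
    using that norm_diff_if_triangle_eq [of "z - d" "y - d"] by (auto simp: mid)
  then have "\<bar>norm (z - a) - norm (y - a)\<bar> = norm (z - y)"
    "\<bar>norm (z - b) - norm (y - b)\<bar> = norm (z - y)"
    "\<bar>norm (z - c) - norm (y - c)\<bar> = norm (z - y)"
    by simp_all
  then have "norm (z - y) = 0"
    using eq unfolding ft_objective_def by linarith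
  then show ?thesis
    by simp
qed

section \<open>Optimality conditions\<close>

lemma ft_solution_regular_iff:
  assumes "x \<noteq> a" "x \<noteq> b" "x \<noteq> c"
  shows "ft_solution a b c x \<longleftrightarrow> sgn (x - a) + sgn (x - b) + sgn (x - c) = 0"
    (is "_ \<longleftrightarrow> ?w = 0")
proof
  assume "ft_solution a b c x"
  then have min: "ft_objective a b c x \<le> ft_objective a b c (x + h)" for h
    by (simp add: ft_solution_iff)
  define K where "K d = 1 / (2 * norm (x - d))" for d
  have up: "norm (x + h - d) \<le> norm (x - d) + sgn (x - d) \<bullet> h + K d * (norm h)\<^sup>2" if "x \<noteq> d" for d h
    using norm_add_le_quadratic [of "x - d" h] that by (simp add: K_def algebra_simps)
  have "norm ?w \<le> 0"
  proof (rule norm_le_if_first_order)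
    show "0 < K a + K b + K c"
      using assms by (simp add: K_def add_pos_pos)
    show "0 \<le> 0 * norm h + ?w \<bullet> h + (K a + K b + K c) * (norm h)\<^sup>2" for h
      using min [of h] up [OF assms(1), of h] up [OF assms(2), of h] up [OF assms(3), of h]
      unfolding ft_objective_def by (simp add: inner_add_left distrib_right)
  qed simp
  then show "?w = 0"
    by simp
next
  assume w: "?w = 0"
  have lo: "norm (x - d) + sgn (x - d) \<bullet> (y - x) \<le> norm (y - d)" if "x \<noteq> d" for d y
    using norm_add_ge_subgradient [of "x - d" "y - x"] that by simp
  have "ft_objective a b c x \<le> ft_objective a b c y" for y
  proof -
    have "?w \<bullet> (y - x) = 0"
      using w by simp
    then show ?thesis
      using lo [OF assms(1), of y] lo [OF assms(2), of y] lo [OF assms(3), of y]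
      unfolding ft_objective_def by (simp add: inner_add_left)
  qed
  then show "ft_solution a b c x"
    by (simp add: ft_solution_iff)
qed

text \<open>The term of \<open>a\<close> itself adds \<open>norm h\<close> when moving by
  \<open>h\<close>, that is, slope 1 in every direction; this can absorb a gradient
  \<open>?w\<close> of the other two terms of norm at most 1.\<close>

lemma ft_solution_vertex_iff:
  assumes "a \<noteq> b" "a \<noteq> c"
  shows "ft_solution a b c a \<longleftrightarrow> norm (sgn (a - b) + sgn (a - c)) \<le> 1"
    (is "_ \<longleftrightarrow> norm ?w \<le> 1")
proof
  assume "ft_solution a b c a"
  then have min: "ft_objective a b c a \<le> ft_objective a b c (a + h)" for h
    by (simp add: ft_solution_iff)
  define K where "K d = 1 / (2 * norm (a - d))" for d
  have up: "norm (a + h - d) \<le> norm (a - d) + sgn (a - d) \<bullet> h + K d * (norm h)\<^sup>2" if "a \<noteq> d" for d h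
    using norm_add_le_quadratic [of "a - d" h] that by (simp add: K_def algebra_simps)
  show "norm ?w \<le> 1"
  proof (rule norm_le_if_first_order)
    show "0 < K b + K c"
      using assms by (simp add: K_def add_pos_pos)
    show "0 \<le> 1 * norm h + ?w \<bullet> h + (K b + K c) * (norm h)\<^sup>2" for h
      using min [of h] up [OF assms(1), of h] up [OF assms(2), of h]
      unfolding ft_objective_def by (simp add: inner_add_left distrib_right)
  qed simp
next
  assume w: "norm ?w \<le> 1"
  have lo: "norm (a - d) + sgn (a - d) \<bullet> (y - a) \<le> norm (y - d)" if "a \<noteq> d" for d y
    using norm_add_ge_subgradient [of "a - d" "y - a"] that by simp
  have "ft_objective a b c a \<le> ft_objective a b c y" for y
  proof -
    have "- (?w \<bullet> (y - a)) \<le> norm ?w * norm (y - a)"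
      using norm_cauchy_schwarz [of "- ?w" "y - a"] by (metis inner_minus_left norm_minus_cancel)
    also have "\<dots> \<le> norm (y - a)"
      using w by (simp add: mult_left_le_one_le)
    finally show ?thesis
      using lo [OF assms(1), of y] lo [OF assms(2), of y]
      unfolding ft_objective_def by (simp add: inner_add_left)
  qed
  then show "ft_solution a b c a"
    by (simp add: ft_solution_iff)
qed

lemma ft_solution_vertex_iff_vec_cos:
  assumes "a \<noteq> b" "a \<noteq> c"
  shows "ft_solution a b c a \<longleftrightarrow> vec_cos (sgn (a - b)) (sgn (a - c)) \<le> - 1 / 2"
  using assms by (simp add: ft_solution_vertex_iff norm_add_unit_le_1_iff norm_sgn vec_cos_unit)

lemma ft_solution_regular_iff_vec_cos:
  assumes "x \<noteq> a" "x \<noteq> b" "x \<noteq> c"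
  shows "ft_solution a b c x \<longleftrightarrow>
    vec_cos (sgn (x - a)) (sgn (x - b)) = - 1 / 2 \<and>
    vec_cos (sgn (x - b)) (sgn (x - c)) = - 1 / 2 \<and>
    vec_cos (sgn (x - c)) (sgn (x - a)) = - 1 / 2"
  using assms by (simp add: ft_solution_regular_iff unit_vectors_sum_eq_0_iff norm_sgn vec_cos_unit)

theorem proposition2p7:
  fixes a1 a2 a3 x v1 v2 v3 :: "real ^ 'n"
  assumes "a1 \<noteq> a2" and "a2 \<noteq> a3" and "a3 \<noteq> a1"
    and "x \<noteq> a1 \<Longrightarrow> v1 = (x - a1) /\<^sub>R norm (x - a1)"
    and "x \<noteq> a2 \<Longrightarrow> v2 = (x - a2) /\<^sub>R norm (x - a2)"
    and "x \<noteq> a3 \<Longrightarrow> v3 = (x - a3) /\<^sub>R norm (x - a3)"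
  shows "(\<exists>!y. ft_solution a1 a2 a3 y) \<and>
    (x \<notin> {a1, a2, a3} \<longrightarrow>
      (ft_solution a1 a2 a3 x \<longleftrightarrow>
        vec_cos v1 v2 = - 1 / 2 \<and> vec_cos v2 v3 = - 1 / 2 \<and> vec_cos v3 v1 = - 1 / 2)) \<and>
    (x = a1 \<longrightarrow> (ft_solution a1 a2 a3 x \<longleftrightarrow> vec_cos v2 v3 \<le> - 1 / 2)) \<and>
    (x = a2 \<longrightarrow> (ft_solution a1 a2 a3 x \<longleftrightarrow> vec_cos v3 v1 \<le> - 1 / 2)) \<and>
    (x = a3 \<longrightarrow> (ft_solution a1 a2 a3 x \<longleftrightarrow> vec_cos v1 v2 \<le> - 1 / 2))"
proof (intro conjI impI)
  have v: "x \<noteq> a1 \<Longrightarrow> v1 = sgn (x - a1)" "x \<noteq> a2 \<Longrightarrow> v2 = sgn (x - a2)"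
    "x \<noteq> a3 \<Longrightarrow> v3 = sgn (x - a3)"
    using assms(4-6) by (simp_all add: sgn_div_norm)
  show "\<exists>!y. ft_solution a1 a2 a3 y"
    using ft_solution_exists ft_solution_unique by blast
  show "ft_solution a1 a2 a3 x \<longleftrightarrow>
      vec_cos v1 v2 = - 1 / 2 \<and> vec_cos v2 v3 = - 1 / 2 \<and> vec_cos v3 v1 = - 1 / 2"
    if "x \<notin> {a1, a2, a3}"
    using that v ft_solution_regular_iff_vec_cos [of x a1 a2 a3] by simp
  show "ft_solution a1 a2 a3 x \<longleftrightarrow> vec_cos v2 v3 \<le> - 1 / 2" if "x = a1"
    using that assms(1-3) v(2,3) ft_solution_vertex_iff_vec_cos [of a1 a2 a3] by simp
  \<comment> \<open>The cyclic order of the points gives the cosine with \<open>v3\<close> before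
    \<open>v1\<close>. Fixing the first argument of the rotation keeps the rewriting from
    looping.\<close>
  show "ft_solution a1 a2 a3 x \<longleftrightarrow> vec_cos v3 v1 \<le> - 1 / 2" if "x = a2"
    using that assms(1-3) v(1,3) ft_solution_vertex_iff_vec_cos [of a2 a3 a1]
    by (simp add: ft_solution_rotate [of a1])
  show "ft_solution a1 a2 a3 x \<longleftrightarrow> vec_cos v1 v2 \<le> - 1 / 2" if "x = a3"
    using that assms(1-3) v(1,2) ft_solution_vertex_iff_vec_cos [of a3 a1 a2]
    by (simp add: ft_solution_rotate [of a3])
qed

end
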